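(* Let $\mathbf{L}$ be the category of all (connected) large scale resemblance spaces and LS.R mappings. Let $\mathbf{A}$ and $\mathbf{R}$ be the full subcategories of $\mathbf{L}$ whose objects are, respectively, all A-LS.R spaces and all LS-regular LS.R spaces. Then: (i) $\mathbf{A}$ is isomorphic to the category of all asymptotic resemblance spaces and AS.R mappings. (ii) $\mathbf{A}$ is a reflective full subcategory of $\mathbf{R}$.
   Context: $\mathcal{P}(X)$ is the power set of $X$. A large scale resemblance (LS.R) on a nonempty set $X$ is $\mathfrak{C}\subseteq\mathcal{P}(\mathcal{P}(X))$ such that: (i) $\{A\}\in\mathfrak{C}$ for all $A\subseteq X$; (ii) if $\mathcal{B}\subseteq\mathcal{A}\in\mathfrak{C}$ then $\mathcal{B}\in\mathfrak{C}$; (iii) if $\mathcal{A},\mathcal{B}\in\mathfrak{C}$ and $\mathcal{A}\cap\mathcal{B}\ne\emptyset$ then $\mathcal{A}\cup\mathcal{B}\in\mathfrak{C}$; (iv) if $\mathcal{A},\mathcal{B}\in\mathfrak{C}$ then $\mathcal{A}\vee\mathcal{B}=\{A\cup B\mid A\in\mathcal{A},B\in\mathcal{B}\}\in\mathfrak{C}$. The pair $(X,\mathfrak{C})$ is an LS.R space. It is connected if $\{\{x\},\{y\}\}\in\mathfrak{C}$ for all $x,y\in X$; all LS.R spaces are assumed connected. A set $B\subseteq X$ is bounded if $B=\emptyset$ or $\{B,\{x\}\}\in\mathfrak{C}$ for some $x\in X$. A map $f:(X,\mathfrak{C})\to(Y,\mathfrak{C}')$ is an LS.R mapping if inverse images of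 bounded sets are bounded and $f(\mathcal{A})=\{f(A)\mid A\in\mathcal{A}\}\in\mathfrak{C}'$ for all $\mathcal{A}\in\mathfrak{C}$. $(X,\mathfrak{C})$ is LS-regular if whenever $\mathcal{A}\in\mathfrak{C}$ and $A_1\cup A_2\in\mathcal{A}$ for nonempty $A_1,A_2\subseteq X$, there are $\mathcal{A}_1,\mathcal{A}_2\in\mathfrak{C}$ with $A_1\in\mathcal{A}_1$, $A_2\in\mathcal{A}_2$ and $\mathcal{A}\subseteq\mathcal{A}_1\vee\mathcal{A}_2$. It is an A-LS.R space if it is LS-regular and, for every $\mathcal{A}\subseteq\mathcal{P}(X)$ such that $\{A,B\}\in\mathfrak{C}$ for all $A,B\in\mathcal{A}$, one has $\mathcal{A}\in\mathfrak{C}$. An asymptotic resemblance (AS.R) on a set $X$ is an equivalence relation $\lambda$ on $\mathcal{P}(X)$ such that: (i) if $A_1\lambda B_1$ and $A_2\lambda B_2$ then $(A_1\cup A_2)\lambda(B_1\cup B_2)$; (ii) if $(A_1\cup A_2)\lambda B$ with $A_1,A_2,B$ nonempty subsets of $X$, then there are nonempty $B_1,B_2$ with $B=B_1\cup B_2$ and $A_i\lambda B_i$ for $i=1,2$. The pair $(X,\lambda)$ is an asymptotic resemblance space (AS.R space). A set $D\subseteq X$ is bounded if $D=\emptyset$ or $D\lambda\{x\}$ for some $x\in X$. An AS.R mapping $f:(X,\lambda)\to(Y,\lambda')$ is a map for which inverse images of bounded sets are bounded and $A\lambda B$ implies $f(A)\lambda' f(B)$ for all $A,B\subseteq X$.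
   Formalization: In (i), asymptotic resemblance spaces are taken nonempty and connected ({x} λ {y} for all points x, y); without this the claim fails: the empty space would be an initial object, which A lacks, and the discrete two-point space would have no counterpart in A. *)

theory Defs
  imports Main "HOL-Library.FuncSet"
begin

section \<open>Categories\<close>

text \<open>Composition is in applicative order: \<open>Cmp C g f\<close> is \<open>g\<close> after \<open>f\<close>.\<close>

record ('o, 'm) cat =
  Ob :: "'o set"
  Ar :: "'m set"
  Src :: "'m \<Rightarrow> 'o"
  Tgt :: "'m \<Rightarrow> 'o"
  Ident :: "'o \<Rightarrow> 'm"
  Cmp :: "'m \<Rightarrow> 'm \<Rightarrow> 'm"

definition cat_hom :: "('o, 'm) cat \<Rightarrow> 'o \<Rightarrow> 'o \<Rightarrow> 'm set" where
  "cat_hom C a b = {f \<in> Ar C. Src C f = a \<and> Tgt C f = b}"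

definition category :: "('o, 'm) cat \<Rightarrow> bool" where
  "category C \<longleftrightarrow>
     (\<forall>f\<in>Ar C. Src C f \<in> Ob C \<and> Tgt C f \<in> Ob C) \<and>
     (\<forall>a\<in>Ob C. Ident C a \<in> cat_hom C a a) \<and>
     (\<forall>f\<in>Ar C. \<forall>g\<in>Ar C. Src C g = Tgt C f \<longrightarrow>
        Cmp C g f \<in> cat_hom C (Src C f) (Tgt C g)) \<and>
     (\<forall>f\<in>Ar C. Cmp C f (Ident C (Src C f)) = f \<and> Cmp C (Ident C (Tgt C f)) f = f) \<and>
     (\<forall>f\<in>Ar C. \<forall>g\<in>Ar C. \<forall>h\<in>Ar C. Src C g = Tgt C f \<longrightarrow> Src C h = Tgt C g \<longrightarrow>
        Cmp C h (Cmp C g f) = Cmp C (Cmp C h g) f)"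

definition is_functor ::
  "('o, 'm) cat \<Rightarrow> ('p, 'n) cat \<Rightarrow> ('o \<Rightarrow> 'p) \<Rightarrow> ('m \<Rightarrow> 'n) \<Rightarrow> bool" where
  "is_functor C D Fo Fa \<longleftrightarrow>
     category C \<and> category D \<and>
     (\<forall>a\<in>Ob C. Fo a \<in> Ob D) \<and>
     (\<forall>f\<in>Ar C. Fa f \<in> cat_hom D (Fo (Src C f)) (Fo (Tgt C f))) \<and>
     (\<forall>a\<in>Ob C. Fa (Ident C a) = Ident D (Fo a)) \<and>
     (\<forall>f\<in>Ar C. \<forall>g\<in>Ar C. Src C g = Tgt C f \<longrightarrow> Fa (Cmp C g f) = Cmp D (Fa g) (Fa f))"

definition isomorphic_categories :: "('o, 'm) cat \<Rightarrow> ('p, 'n) cat \<Rightarrow> bool" where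
  "isomorphic_categories C D \<longleftrightarrow>
     (\<exists>Fo Fa Go Ga. is_functor C D Fo Fa \<and> is_functor D C Go Ga \<and>
        (\<forall>a\<in>Ob C. Go (Fo a) = a) \<and> (\<forall>f\<in>Ar C. Ga (Fa f) = f) \<and>
        (\<forall>b\<in>Ob D. Fo (Go b) = b) \<and> (\<forall>g\<in>Ar D. Fa (Ga g) = g))"

definition full_subcat :: "('o, 'm) cat \<Rightarrow> 'o set \<Rightarrow> ('o, 'm) cat" where
  "full_subcat C S =
     \<lparr>Ob = Ob C \<inter> S, Ar = {f \<in> Ar C. Src C f \<in> S \<and> Tgt C f \<in> S},
      Src = Src C, Tgt = Tgt C, Ident = Ident C, Cmp = Cmp C\<rparr>"

definition full_subcategory :: "('o, 'm) cat \<Rightarrow> ('o, 'm) cat \<Rightarrow> bool" where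
  "full_subcategory S C \<longleftrightarrow>
     category S \<and> category C \<and> Ob S \<subseteq> Ob C \<and>
     (\<forall>a\<in>Ob S. \<forall>b\<in>Ob S. cat_hom S a b = cat_hom C a b) \<and>
     (\<forall>a\<in>Ob S. Ident S a = Ident C a) \<and>
     (\<forall>f\<in>Ar S. \<forall>g\<in>Ar S. Src S g = Tgt S f \<longrightarrow> Cmp S g f = Cmp C g f)"

text \<open>The functor \<open>F : C \<rightarrow> D\<close> is left adjoint to \<open>G : D \<rightarrow> C\<close>, by a natural family of
  bijections \<open>D(F x, y) \<cong> C(x, G y)\<close>.\<close>

definition left_adjoint ::
  "('o, 'm) cat \<Rightarrow> ('p, 'n) cat \<Rightarrow> ('o \<Rightarrow> 'p) \<Rightarrow> ('m \<Rightarrow> 'n) \<Rightarrow> ('p \<Rightarrow> 'o) \<Rightarrow> ('n \<Rightarrow> 'm) \<Rightarrow> bool" where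
  "left_adjoint C D Fo Fa Go Ga \<longleftrightarrow>
     is_functor C D Fo Fa \<and> is_functor D C Go Ga \<and>
     (\<exists>\<phi>. (\<forall>x\<in>Ob C. \<forall>y\<in>Ob D.
              bij_betw (\<phi> x y) (cat_hom D (Fo x) y) (cat_hom C x (Go y))) \<and>
          (\<forall>x\<in>Ob C. \<forall>x'\<in>Ob C. \<forall>y\<in>Ob D. \<forall>y'\<in>Ob D.
             \<forall>f\<in>cat_hom C x' x. \<forall>g\<in>cat_hom D y y'. \<forall>h\<in>cat_hom D (Fo x) y.
               \<phi> x' y' (Cmp D g (Cmp D h (Fa f))) = Cmp C (Ga g) (Cmp C (\<phi> x y h) f)))"

definition reflective_full_subcategory :: "('o, 'm) cat \<Rightarrow> ('o, 'm) cat \<Rightarrow> bool" where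
  "reflective_full_subcategory S C \<longleftrightarrow>
     full_subcategory S C \<and> (\<exists>Lo La. left_adjoint C S Lo La (\<lambda>a. a) (\<lambda>f. f))"

text \<open>Spaces are pairs (carrier, structure) with carrier a subset of the type \<open>'a\<close>, which plays
  the role of the universe. A morphism carries its source and target; its underlying function is
  extensional on the source carrier, so that equality of morphisms is equality of maps.\<close>

type_synonym ('a, 's) space_map = "('a set \<times> 's) \<times> ('a \<Rightarrow> 'a) \<times> ('a set \<times> 's)"

definition structured_cat ::
  "('a set \<times> 's) set \<Rightarrow> ('a set \<times> 's \<Rightarrow> 'a set \<times> 's \<Rightarrow> ('a \<Rightarrow> 'a) \<Rightarrow> bool) \<Rightarrow>
   ('a set \<times> 's, ('a, 's) space_map) cat" where
  "structured_cat \<O> M =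
     \<lparr>Ob = \<O>,
      Ar = {(P, f, Q). P \<in> \<O> \<and> Q \<in> \<O> \<and> f \<in> fst P \<rightarrow>\<^sub>E fst Q \<and> M P Q f},
      Src = (\<lambda>(P, f, Q). P),
      Tgt = (\<lambda>(P, f, Q). Q),
      Ident = (\<lambda>P. (P, restrict (\<lambda>x. x) (fst P), P)),
      Cmp = (\<lambda>(Q, g, R) (P, f, Q'). (P, compose (fst P) g f, R))\<rparr>"


section \<open>Large scale resemblances\<close>

definition family_join :: "'a set set \<Rightarrow> 'a set set \<Rightarrow> 'a set set" (infixl \<open>\<or>\<^sub>f\<close> 65) where
  "\<A> \<or>\<^sub>f \<B> = {A \<union> B | A B. A \<in> \<A> \<and> B \<in> \<B>}"

definition ls_resemblance :: "'a set \<Rightarrow> 'a set set set \<Rightarrow> bool" where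
  "ls_resemblance X \<CC> \<longleftrightarrow>
     X \<noteq> {} \<and> \<CC> \<subseteq> Pow (Pow X) \<and>
     (\<forall>A\<subseteq>X. {A} \<in> \<CC>) \<and>
     (\<forall>\<A> \<B>. \<B> \<subseteq> \<A> \<and> \<A> \<in> \<CC> \<longrightarrow> \<B> \<in> \<CC>) \<and>
     (\<forall>\<A>\<in>\<CC>. \<forall>\<B>\<in>\<CC>. \<A> \<inter> \<B> \<noteq> {} \<longrightarrow> \<A> \<union> \<B> \<in> \<CC>) \<and>
     (\<forall>\<A>\<in>\<CC>. \<forall>\<B>\<in>\<CC>. \<A> \<or>\<^sub>f \<B> \<in> \<CC>)"

definition lsr_connected :: "'a set \<Rightarrow> 'a set set set \<Rightarrow> bool" where
  "lsr_connected X \<CC> \<longleftrightarrow> (\<forall>x\<in>X. \<forall>y\<in>X. {{x}, {y}} \<in> \<CC>)"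

definition lsr_bounded :: "'a set \<Rightarrow> 'a set set set \<Rightarrow> 'a set \<Rightarrow> bool" where
  "lsr_bounded X \<CC> B \<longleftrightarrow> B \<subseteq> X \<and> (B = {} \<or> (\<exists>x\<in>X. {B, {x}} \<in> \<CC>))"

definition lsr_mapping ::
  "'a set \<Rightarrow> 'a set set set \<Rightarrow> 'b set \<Rightarrow> 'b set set set \<Rightarrow> ('a \<Rightarrow> 'b) \<Rightarrow> bool" where
  "lsr_mapping X \<CC> Y \<DD> f \<longleftrightarrow>
     f \<in> X \<rightarrow> Y \<and>
     (\<forall>B. lsr_bounded Y \<DD> B \<longrightarrow> lsr_bounded X \<CC> (X \<inter> f -` B)) \<and>
     (\<forall>\<A>\<in>\<CC>. (\<lambda>A. f ` A) ` \<A> \<in> \<DD>)"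

definition ls_regular :: "'a set \<Rightarrow> 'a set set set \<Rightarrow> bool" where
  "ls_regular X \<CC> \<longleftrightarrow>
     (\<forall>\<A>\<in>\<CC>. \<forall>A\<^sub>1 A\<^sub>2. A\<^sub>1 \<subseteq> X \<and> A\<^sub>2 \<subseteq> X \<and> A\<^sub>1 \<noteq> {} \<and> A\<^sub>2 \<noteq> {} \<and> A\<^sub>1 \<union> A\<^sub>2 \<in> \<A> \<longrightarrow>
        (\<exists>\<A>\<^sub>1\<in>\<CC>. \<exists>\<A>\<^sub>2\<in>\<CC>. A\<^sub>1 \<in> \<A>\<^sub>1 \<and> A\<^sub>2 \<in> \<A>\<^sub>2 \<and> \<A> \<subseteq> \<A>\<^sub>1 \<or>\<^sub>f \<A>\<^sub>2))"

definition a_lsr :: "'a set \<Rightarrow> 'a set set set \<Rightarrow> bool" where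
  "a_lsr X \<CC> \<longleftrightarrow>
     ls_regular X \<CC> \<and>
     (\<forall>\<A>. \<A> \<subseteq> Pow X \<and> (\<forall>A\<in>\<A>. \<forall>B\<in>\<A>. {A, B} \<in> \<CC>) \<longrightarrow> \<A> \<in> \<CC>)"

type_synonym 'a lsr_space = "'a set \<times> 'a set set set"
type_synonym 'a lsr_cat = "('a lsr_space, ('a, 'a set set set) space_map) cat"

definition LSR_cat :: "'a lsr_cat" where
  "LSR_cat =
     structured_cat {(X, \<CC>). ls_resemblance X \<CC> \<and> lsr_connected X \<CC>}
       (\<lambda>(X, \<CC>) (Y, \<DD>) f. lsr_mapping X \<CC> Y \<DD> f)"

definition ALSR_cat :: "'a lsr_cat" where
  "ALSR_cat = full_subcat LSR_cat {(X, \<CC>). a_lsr X \<CC>}"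

definition LS_regular_cat :: "'a lsr_cat" where
  "LS_regular_cat = full_subcat LSR_cat {(X, \<CC>). ls_regular X \<CC>}"


section \<open>Asymptotic resemblances\<close>

definition asymptotic_resemblance :: "'a set \<Rightarrow> ('a set \<times> 'a set) set \<Rightarrow> bool" where
  "asymptotic_resemblance X \<rho> \<longleftrightarrow>
     equiv (Pow X) \<rho> \<and>
     (\<forall>A\<^sub>1 B\<^sub>1 A\<^sub>2 B\<^sub>2. (A\<^sub>1, B\<^sub>1) \<in> \<rho> \<and> (A\<^sub>2, B\<^sub>2) \<in> \<rho> \<longrightarrow> (A\<^sub>1 \<union> A\<^sub>2, B\<^sub>1 \<union> B\<^sub>2) \<in> \<rho>) \<and>
     (\<forall>A\<^sub>1 A\<^sub>2 B. A\<^sub>1 \<subseteq> X \<and> A\<^sub>2 \<subseteq> X \<and> B \<subseteq> X \<and> A\<^sub>1 \<noteq> {} \<and> A\<^sub>2 \<noteq> {} \<and> B \<noteq> {} \<and>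
        (A\<^sub>1 \<union> A\<^sub>2, B) \<in> \<rho> \<longrightarrow>
        (\<exists>B\<^sub>1 B\<^sub>2. B\<^sub>1 \<noteq> {} \<and> B\<^sub>2 \<noteq> {} \<and> B = B\<^sub>1 \<union> B\<^sub>2 \<and> (A\<^sub>1, B\<^sub>1) \<in> \<rho> \<and> (A\<^sub>2, B\<^sub>2) \<in> \<rho>))"

definition asr_connected :: "'a set \<Rightarrow> ('a set \<times> 'a set) set \<Rightarrow> bool" where
  "asr_connected X \<rho> \<longleftrightarrow> (\<forall>x\<in>X. \<forall>y\<in>X. ({x}, {y}) \<in> \<rho>)"

definition asr_bounded :: "'a set \<Rightarrow> ('a set \<times> 'a set) set \<Rightarrow> 'a set \<Rightarrow> bool" where
  "asr_bounded X \<rho> D \<longleftrightarrow> D \<subseteq> X \<and> (D = {} \<or> (\<exists>x\<in>X. (D, {x}) \<in> \<rho>))"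

definition asr_mapping ::
  "'a set \<Rightarrow> ('a set \<times> 'a set) set \<Rightarrow> 'b set \<Rightarrow> ('b set \<times> 'b set) set \<Rightarrow> ('a \<Rightarrow> 'b) \<Rightarrow> bool" where
  "asr_mapping X \<rho> Y \<sigma> f \<longleftrightarrow>
     f \<in> X \<rightarrow> Y \<and>
     (\<forall>D. asr_bounded Y \<sigma> D \<longrightarrow> asr_bounded X \<rho> (X \<inter> f -` D)) \<and>
     (\<forall>A B. A \<subseteq> X \<and> B \<subseteq> X \<and> (A, B) \<in> \<rho> \<longrightarrow> (f ` A, f ` B) \<in> \<sigma>)"

type_synonym 'a asr_space = "'a set \<times> ('a set \<times> 'a set) set"
type_synonym 'a asr_cat = "('a asr_space, ('a, ('a set \<times> 'a set) set) space_map) cat"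

text \<open>As for large scale resemblance spaces, carriers are nonempty and spaces are connected.
  Without these conventions the category would have further objects (the empty space, the
  disconnected two-point space) with no counterpart among the connected large scale
  resemblance spaces.\<close>

definition ASR_cat :: "'a asr_cat" where
  "ASR_cat =
     structured_cat {(X, \<rho>). X \<noteq> {} \<and> asymptotic_resemblance X \<rho> \<and> asr_connected X \<rho>}
       (\<lambda>(X, \<rho>) (Y, \<sigma>) f. asr_mapping X \<rho> Y \<sigma> f)"

end

theory Submission
  imports Defs
begin

text \<open>A large scale resemblance \<open>\<CC>\<close> induces the relation \<open>{A, B} \<in> \<CC>\<close> on subsets, and a relation
  \<open>\<rho>\<close> induces the families all of whose members are pairwise related. LS-regularity of \<open>\<CC>\<close> yields
  the splitting axiom of asymptotic resemblances and conversely; the only delicate point is the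
  empty set, which may be related to a nonempty one. The two assignments are mutually
  inverse exactly on A-LS.R structures, and their composite, which enlarges \<open>\<CC>\<close> to all families
  pairwise contained in \<open>\<CC>\<close>, is the reflector: all functors and units are the identity
  on underlying maps, so everything reduces to comparing which maps are morphisms.\<close>

section \<open>Categories of structured sets\<close>

text \<open>Closure of the morphism predicate under identities and composites is all that has to be
  assumed: the unit and associativity laws are those of extensional functions.\<close>

locale structured_maps =
  fixes \<O> :: "('a set \<times> 's) set"
    and M :: "'a set \<times> 's \<Rightarrow> 'a set \<times> 's \<Rightarrow> ('a \<Rightarrow> 'a) \<Rightarrow> bool"
  assumes ident: "P \<in> \<O> \<Longrightarrow> M P P (restrict (\<lambda>x. x) (fst P))"
    and comp: "\<lbrakk>P \<in> \<O>; Q \<in> \<O>; R \<in> \<O>; f \<in> fst P \<rightarrow>\<^sub>E fst Q; g \<in> fst Q \<rightarrow>\<^sub>E fst R; M P Q f; M Q R g\<rbrakk>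
      \<Longrightarrow> M P R (compose (fst P) g f)"
begin

lemma category: "category (structured_cat \<O> M)"
  unfolding category_def
proof (intro conjI ballI impI)
  fix f assume "f \<in> Ar (structured_cat \<O> M)"
  then obtain P h Q where f: "f = (P, h, Q)" "P \<in> \<O>" "Q \<in> \<O>" "h \<in> fst P \<rightarrow>\<^sub>E fst Q"
    by (auto simp: structured_cat_def)
  show "Src (structured_cat \<O> M) f \<in> Ob (structured_cat \<O> M)"
    and "Tgt (structured_cat \<O> M) f \<in> Ob (structured_cat \<O> M)"
    using f by (auto simp: structured_cat_def)
  have "compose (fst P) h (restrict (\<lambda>x. x) (fst P)) = h"
    using f(4) by (auto simp: compose_def restrict_def fun_eq_iff PiE_def extensional_def)
  then show "Cmp (structured_cat \<O> M) f
      (Ident (structured_cat \<O> M) (Src (structured_cat \<O> M) f)) = f"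
    by (simp add: f structured_cat_def)
  have "compose (fst P) (restrict (\<lambda>x. x) (fst Q)) h = h"
    using f(4) by (auto simp: compose_def restrict_def fun_eq_iff PiE_def extensional_def)
  then show "Cmp (structured_cat \<O> M)
      (Ident (structured_cat \<O> M) (Tgt (structured_cat \<O> M) f)) f = f"
    by (simp add: f structured_cat_def)
next
  fix a assume "a \<in> Ob (structured_cat \<O> M)"
  then show "Ident (structured_cat \<O> M) a \<in> cat_hom (structured_cat \<O> M) a a"
    using ident by (auto simp: structured_cat_def cat_hom_def)
next
  fix f g assume "f \<in> Ar (structured_cat \<O> M)" "g \<in> Ar (structured_cat \<O> M)"
    and "Src (structured_cat \<O> M) g = Tgt (structured_cat \<O> M) f"
  then obtain P Q R h k where fg: "f = (P, h, Q)" "g = (Q, k, R)" "P \<in> \<O>" "Q \<in> \<O>" "R \<in> \<O>"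
    "h \<in> fst P \<rightarrow>\<^sub>E fst Q" "k \<in> fst Q \<rightarrow>\<^sub>E fst R" "M P Q h" "M Q R k"
    by (auto simp: structured_cat_def)
  moreover have "compose (fst P) k h \<in> fst P \<rightarrow>\<^sub>E fst R"
    using fg by (auto simp: compose_def)
  ultimately show "Cmp (structured_cat \<O> M) g f \<in> cat_hom (structured_cat \<O> M)
      (Src (structured_cat \<O> M) f) (Tgt (structured_cat \<O> M) g)"
    using comp by (simp add: structured_cat_def cat_hom_def)
next
  fix f g h assume "f \<in> Ar (structured_cat \<O> M)" "g \<in> Ar (structured_cat \<O> M)"
    "h \<in> Ar (structured_cat \<O> M)"
    "Src (structured_cat \<O> M) g = Tgt (structured_cat \<O> M) f"
    "Src (structured_cat \<O> M) h = Tgt (structured_cat \<O> M) g"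
  then obtain P Q R S f' g' h' where fgh: "f = (P, f', Q)" "g = (Q, g', R)" "h = (R, h', S)"
    "f' \<in> fst P \<rightarrow>\<^sub>E fst Q"
    by (auto simp: structured_cat_def)
  \<comment> \<open>The composite of \<open>h'\<close> and \<open>g'\<close> on the right is
    truncated to the carrier of \<open>Q\<close>; this changes nothing, because \<open>f'\<close>
    takes values in that carrier.\<close>
  then have "compose (fst P) h' (compose (fst P) g' f') = compose (fst P) (compose (fst Q) h' g') f'"
    by (auto simp: compose_def fun_eq_iff)
  then show "Cmp (structured_cat \<O> M) h (Cmp (structured_cat \<O> M) g f) =
      Cmp (structured_cat \<O> M) (Cmp (structured_cat \<O> M) h g) f"
    by (simp add: fgh structured_cat_def)
qed

lemma restrict_objects: "\<O>' \<subseteq> \<O> \<Longrightarrow> structured_maps \<O>' M"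
  by unfold_locales (use ident comp in blast)+

end

text \<open>Fullness makes this a literal equality of records, so every category of the theorem can
  be treated as a structured category with a suitable object set.\<close>

lemma full_subcat_structured_cat:
  "full_subcat (structured_cat \<O> M) S = structured_cat (\<O> \<inter> S) M"
  by (auto simp: full_subcat_def structured_cat_def)

lemma full_subcategory_structured_cat:
  assumes "structured_maps \<O> M" and "\<O>' \<subseteq> \<O>"
  shows "full_subcategory (structured_cat \<O>' M) (structured_cat \<O> M)"
  using assms structured_maps.category structured_maps.restrict_objects[OF assms]
  by (auto simp: full_subcategory_def structured_cat_def cat_hom_def)

text \<open>Arrow part of a functor that is the identity on underlying maps: arrows store their
  endpoints, so these have to be relabelled.\<close>

definition map_ends ::
  "('a set \<times> 's \<Rightarrow> 'a set \<times> 't) \<Rightarrow> ('a, 's) space_map \<Rightarrow> ('a, 't) space_map" where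
  "map_ends F = (\<lambda>(P, f, Q). (F P, f, F Q))"

lemma is_functor_map_ends:
  assumes "structured_maps \<O> M" and "structured_maps \<O>' M'"
    and ob: "\<And>P. P \<in> \<O> \<Longrightarrow> F P \<in> \<O>'" and carrier: "\<And>P. P \<in> \<O> \<Longrightarrow> fst (F P) = fst P"
    and maps: "\<And>P Q f. \<lbrakk>P \<in> \<O>; Q \<in> \<O>; f \<in> fst P \<rightarrow>\<^sub>E fst Q; M P Q f\<rbrakk> \<Longrightarrow> M' (F P) (F Q) f"
  shows "is_functor (structured_cat \<O> M) (structured_cat \<O>' M') F (map_ends F)"
  using assms structured_maps.category[OF assms(1)] structured_maps.category[OF assms(2)]
  by (auto simp: is_functor_def structured_cat_def cat_hom_def map_ends_def)

text \<open>The equivalence of morphism predicates serves both functors. Read at \<open>G P\<close>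
  and \<open>G Q\<close>, and rewritten with \<open>F (G P) = P\<close>, it is the preservation
  property of \<open>G\<close>.\<close>

lemma isomorphic_structured_cats:
  assumes "structured_maps \<O> M" and "structured_maps \<O>' M'"
    and "\<And>P. P \<in> \<O> \<Longrightarrow> F P \<in> \<O>'" and "\<And>P. P \<in> \<O> \<Longrightarrow> fst (F P) = fst P"
    and "\<And>P Q f. \<lbrakk>P \<in> \<O>; Q \<in> \<O>; f \<in> fst P \<rightarrow>\<^sub>E fst Q\<rbrakk> \<Longrightarrow> M' (F P) (F Q) f \<longleftrightarrow> M P Q f"
    and "\<And>P. P \<in> \<O>' \<Longrightarrow> G P \<in> \<O>" and "\<And>P. P \<in> \<O> \<Longrightarrow> G (F P) = P"
    and "\<And>P. P \<in> \<O>' \<Longrightarrow> F (G P) = P"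
  shows "isomorphic_categories (structured_cat \<O> M) (structured_cat \<O>' M')"
proof -
  have carrier: "fst (G P) = fst P" if "P \<in> \<O>'" for P
    using assms(4,6,8) that by metis
  have "is_functor (structured_cat \<O> M) (structured_cat \<O>' M') F (map_ends F)"
    using assms by (intro is_functor_map_ends) auto
  moreover have "is_functor (structured_cat \<O>' M') (structured_cat \<O> M) G (map_ends G)"
  proof (rule is_functor_map_ends)
    fix P Q f assume *: "P \<in> \<O>'" "Q \<in> \<O>'" "f \<in> fst P \<rightarrow>\<^sub>E fst Q" "M' P Q f"
    then show "M (G P) (G Q) f"
      using assms(5)[of "G P" "G Q" f] assms(6,8) carrier by simp
  qed (use assms carrier in auto)
  ultimately show ?thesis
    unfolding isomorphic_categories_def using assms(3,6-8)
    by (intro exI[of _ F] exI[of _ "map_ends F"] exI[of _ G] exI[of _ "map_ends G"])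
      (auto simp: structured_cat_def map_ends_def)
qed

text \<open>The unit at \<open>P\<close> is carried by the identity map. Assumption
  \<open>unit\<close> says that \<open>P\<close> and \<open>L P\<close> admit the same maps into
  objects of the subcategory, which is the hom-set bijection of the adjunction.\<close>

lemma reflective_structured_cat:
  assumes "structured_maps \<O> M" and "\<O>' \<subseteq> \<O>"
    and ob: "\<And>P. P \<in> \<O> \<Longrightarrow> L P \<in> \<O>'" and carrier: "\<And>P. P \<in> \<O> \<Longrightarrow> fst (L P) = fst P"
    and unit: "\<And>P Q f. \<lbrakk>P \<in> \<O>; Q \<in> \<O>'; f \<in> fst P \<rightarrow>\<^sub>E fst Q\<rbrakk> \<Longrightarrow> M (L P) Q f \<longleftrightarrow> M P Q f"
    and maps: "\<And>P Q f. \<lbrakk>P \<in> \<O>; Q \<in> \<O>; f \<in> fst P \<rightarrow>\<^sub>E fst Q; M P Q f\<rbrakk> \<Longrightarrow> M (L P) (L Q) f"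
  shows "reflective_full_subcategory (structured_cat \<O>' M) (structured_cat \<O> M)"
proof -
  let ?C = "structured_cat \<O> M" and ?D = "structured_cat \<O>' M"
  note sub = structured_maps.restrict_objects[OF assms(1,2)]
  have L: "is_functor ?C ?D L (map_ends L)"
    by (rule is_functor_map_ends[OF assms(1) sub]) (use ob carrier maps in auto)
  have "is_functor ?D ?C (\<lambda>P. P) (map_ends (\<lambda>P. P))"
    by (rule is_functor_map_ends[OF sub assms(1)]) (use \<open>\<O>' \<subseteq> \<O>\<close> in auto)
  moreover have "map_ends (\<lambda>P. P) = (\<lambda>f :: ('a, 'b) space_map. f)"
    by (auto simp: map_ends_def)
  ultimately have I: "is_functor ?D ?C (\<lambda>P. P) (\<lambda>f. f)"
    by simp
  \<comment> \<open>The bijection only relabels the source, from \<open>L P\<close> to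
    \<open>P\<close>; its inverse puts \<open>L P\<close> back.\<close>
  define \<phi> :: "'a set \<times> 'b \<Rightarrow> 'a set \<times> 'b \<Rightarrow> ('a, 'b) space_map \<Rightarrow> ('a, 'b) space_map"
    where "\<phi> P Q = (\<lambda>(P', f, Q'). (P, f, Q'))" for P Q
  have "bij_betw (\<phi> P Q) (cat_hom ?D (L P) Q) (cat_hom ?C P Q)" if "P \<in> \<O>" "Q \<in> \<O>'" for P Q
  proof (rule bij_betw_byWitness[where f' = "\<lambda>(P', f, Q'). (L P, f, Q')"])
    show "\<phi> P Q ` cat_hom ?D (L P) Q \<subseteq> cat_hom ?C P Q"
      using that ob carrier unit \<open>\<O>' \<subseteq> \<O>\<close>
      by (auto simp: \<phi>_def cat_hom_def structured_cat_def)
    show "(\<lambda>(P', f, Q'). (L P, f, Q')) ` cat_hom ?C P Q \<subseteq> cat_hom ?D (L P) Q"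
      using that ob carrier unit \<open>\<O>' \<subseteq> \<O>\<close>
      by (auto simp: \<phi>_def cat_hom_def structured_cat_def)
  qed (auto simp: \<phi>_def cat_hom_def structured_cat_def)
  \<comment> \<open>Naturality is an equality of triples: both sides run from \<open>P'\<close> to
    \<open>Q'\<close> and carry the same composite, truncated to the same carrier because
    \<open>L\<close> preserves carriers.\<close>
  moreover have "\<phi> P' Q' (Cmp ?D g (Cmp ?D h (map_ends L f))) = Cmp ?C g (Cmp ?C (\<phi> P Q h) f)"
    if "P \<in> \<O>" "P' \<in> \<O>" "f \<in> cat_hom ?C P' P" "g \<in> cat_hom ?D Q Q'" "h \<in> cat_hom ?D (L P) Q"
    for P P' Q Q' f g h
    using that carrier by (auto simp: \<phi>_def cat_hom_def structured_cat_def map_ends_def)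
  ultimately have "left_adjoint ?C ?D L (map_ends L) (\<lambda>P. P) (\<lambda>f. f)"
    unfolding left_adjoint_def
    by (intro conjI L I exI[of _ \<phi>]) (auto simp: structured_cat_def)
  then show ?thesis
    using full_subcategory_structured_cat[OF assms(1,2)]
    by (auto simp: reflective_full_subcategory_def)
qed

section \<open>From families to relations and back\<close>

definition pair_rel :: "'a set \<Rightarrow> 'a set set set \<Rightarrow> ('a set \<times> 'a set) set" where
  "pair_rel X \<CC> = {(A, B). A \<subseteq> X \<and> B \<subseteq> X \<and> {A, B} \<in> \<CC>}"

definition clique_families :: "'a set \<Rightarrow> ('a set \<times> 'a set) set \<Rightarrow> 'a set set set" where
  "clique_families X \<rho> = {\<A>. \<A> \<subseteq> Pow X \<and> (\<forall>A\<in>\<A>. \<forall>B\<in>\<A>. (A, B) \<in> \<rho>)}"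

lemma pair_rel_iff: "ls_resemblance X \<CC> \<Longrightarrow> (A, B) \<in> pair_rel X \<CC> \<longleftrightarrow> {A, B} \<in> \<CC>"
  by (auto simp: pair_rel_def ls_resemblance_def)

text \<open>Two members of a family in \<CC> form a subfamily of it, and \<CC> is closed under
  subfamilies. The reverse inclusion is the second A-LS.R condition.\<close>

lemma clique_families_pair_rel_superset:
  assumes "ls_resemblance X \<CC>"
  shows "\<CC> \<subseteq> clique_families X (pair_rel X \<CC>)"
proof
  fix \<A> assume "\<A> \<in> \<CC>"
  then have "\<A> \<subseteq> Pow X"
    using assms by (auto simp: ls_resemblance_def)
  moreover have "{A, B} \<in> \<CC>" if "A \<in> \<A>" "B \<in> \<A>" for A B
  proof -
    have "{A, B} \<subseteq> \<A>" using that by simp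
    then show ?thesis
      using assms \<open>\<A> \<in> \<CC>\<close> unfolding ls_resemblance_def by blast
  qed
  ultimately show "\<A> \<in> clique_families X (pair_rel X \<CC>)"
    by (auto simp: clique_families_def pair_rel_iff[OF assms])
qed

lemma clique_families_pair_rel:
  assumes "ls_resemblance X \<CC>" and "a_lsr X \<CC>"
  shows "clique_families X (pair_rel X \<CC>) = \<CC>"
proof
  show "clique_families X (pair_rel X \<CC>) \<subseteq> \<CC>"
    using assms(2) unfolding clique_families_def a_lsr_def pair_rel_iff[OF assms(1)] by blast
qed (rule clique_families_pair_rel_superset[OF assms(1)])

text \<open>For \<open>{A, B}\<close> to be a clique, all four pairs from \<open>A\<close> and
  \<open>B\<close> must be related; reflexivity and symmetry reduce this to the single pair
  \<open>(A, B)\<close>.\<close>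

lemma pair_rel_clique_families:
  assumes "equiv (Pow X) \<rho>"
  shows "pair_rel X (clique_families X \<rho>) = \<rho>"
proof -
  have "\<rho> \<subseteq> Pow X \<times> Pow X" "refl_on (Pow X) \<rho>" "sym \<rho>"
    using assms by (auto simp: equiv_def refl_on_def)
  then show ?thesis
    by (auto simp: pair_rel_def clique_families_def refl_on_def dest: symD)
qed

text \<open>Transitivity is the union axiom: \<open>{A, B}\<close> and \<open>{B, D}\<close> share
  the member \<open>B\<close>, so their union lies in \<CC> and contains \<open>{A, D}\<close>.
  Reflexivity is the singleton axiom, since \<open>{A, A} = {A}\<close>.\<close>

lemma pair_rel_equiv:
  assumes "ls_resemblance X \<CC>"
  shows "equiv (Pow X) (pair_rel X \<CC>)"
proof -
  have "(A, D) \<in> pair_rel X \<CC>" if "(A, B) \<in> pair_rel X \<CC>" "(B, D) \<in> pair_rel X \<CC>" for A B D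
  proof -
    have "{A, B} \<union> {B, D} \<in> \<CC>"
      using that assms unfolding pair_rel_iff[OF assms] by (auto simp: ls_resemblance_def)
    moreover have "{A, D} \<subseteq> {A, B} \<union> {B, D}"
      by auto
    ultimately show ?thesis
      using assms unfolding pair_rel_iff[OF assms] ls_resemblance_def by blast
  qed
  then have "trans (pair_rel X \<CC>)"
    by (blast intro: transI)
  moreover have "refl_on (Pow X) (pair_rel X \<CC>)"
    using assms by (auto simp: refl_on_def pair_rel_def ls_resemblance_def)
  moreover have "sym (pair_rel X \<CC>)"
    by (auto simp: sym_def pair_rel_def insert_commute)
  moreover have "pair_rel X \<CC> \<subseteq> Pow X \<times> Pow X"
    by (auto simp: pair_rel_def)
  ultimately show ?thesis
    by (auto simp: equiv_def)
qed

text \<open>The join of the two pairs consists of the four cross unions, among them the two that are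
  wanted.\<close>

lemma pair_rel_Un:
  assumes "ls_resemblance X \<CC>" "(A, B) \<in> pair_rel X \<CC>" "(A', B') \<in> pair_rel X \<CC>"
  shows "(A \<union> A', B \<union> B') \<in> pair_rel X \<CC>"
proof -
  have "{A, B} \<or>\<^sub>f {A', B'} \<in> \<CC>"
    using assms unfolding pair_rel_iff[OF assms(1)] by (auto simp: ls_resemblance_def)
  moreover have "{A \<union> A', B \<union> B'} \<subseteq> {A, B} \<or>\<^sub>f {A', B'}"
    by (auto simp: family_join_def)
  ultimately show ?thesis
    using assms(1) unfolding pair_rel_iff[OF assms(1)] ls_resemblance_def by blast
qed

text \<open>Adding a point \<open>a\<close> of \<open>A\<close> to both sides of the relation
  between \<open>A\<close> and the empty set shows that \<open>A\<close> is related to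
  \<open>{a}\<close>. Connectedness then links every \<open>{b}\<close> to \<open>{a}\<close>, hence
  to \<open>A\<close> and to the empty set.\<close>

lemma points_related_empty:
  assumes lsr: "ls_resemblance X \<CC>" and "lsr_connected X \<CC>"
    and rel: "(A, {}) \<in> pair_rel X \<CC>" and "A \<noteq> {}" and b: "b \<in> X"
  shows "({b}, {}) \<in> pair_rel X \<CC>"
proof -
  note eq = pair_rel_equiv[OF lsr]
  from \<open>A \<noteq> {}\<close> obtain a where a: "a \<in> A" by auto
  then have "a \<in> X"
    using rel by (auto simp: pair_rel_def)
  then have "({a}, {a}) \<in> pair_rel X \<CC>"
    using eq by (auto simp: equiv_def refl_on_def)
  then have "(A \<union> {a}, {} \<union> {a}) \<in> pair_rel X \<CC>"
    by (rule pair_rel_Un[OF lsr rel])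
  then have "(A, {a}) \<in> pair_rel X \<CC>"
    using a by (simp add: insert_absorb)
  moreover have "({b}, {a}) \<in> pair_rel X \<CC>"
    using assms(2) b \<open>a \<in> X\<close> by (auto simp: lsr_connected_def pair_rel_def)
  ultimately show ?thesis
    using eq rel by (meson equivE symD transD)
qed

section \<open>LS-regularity and the splitting axiom, in both directions\<close>

lemma ls_regularE:
  assumes "ls_regular X \<CC>" "\<A> \<in> \<CC>" "A\<^sub>1 \<subseteq> X" "A\<^sub>2 \<subseteq> X" "A\<^sub>1 \<noteq> {}" "A\<^sub>2 \<noteq> {}" "A\<^sub>1 \<union> A\<^sub>2 \<in> \<A>"
  obtains \<A>\<^sub>1 \<A>\<^sub>2 where "\<A>\<^sub>1 \<in> \<CC>" "\<A>\<^sub>2 \<in> \<CC>" "A\<^sub>1 \<in> \<A>\<^sub>1" "A\<^sub>2 \<in> \<A>\<^sub>2" "\<A> \<subseteq> \<A>\<^sub>1 \<or>\<^sub>f \<A>\<^sub>2"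
  using assms(1)[unfolded ls_regular_def, rule_format, OF assms(2), of A\<^sub>1 A\<^sub>2] assms(3-7) that
  by blast

lemma asymptotic_resemblance_Un:
  "\<lbrakk>asymptotic_resemblance X \<rho>; (A\<^sub>1, B\<^sub>1) \<in> \<rho>; (A\<^sub>2, B\<^sub>2) \<in> \<rho>\<rbrakk> \<Longrightarrow> (A\<^sub>1 \<union> A\<^sub>2, B\<^sub>1 \<union> B\<^sub>2) \<in> \<rho>"
  by (simp add: asymptotic_resemblance_def)

lemma asymptotic_resemblance_splitE:
  assumes "asymptotic_resemblance X \<rho>" "A\<^sub>1 \<subseteq> X" "A\<^sub>2 \<subseteq> X" "B \<subseteq> X" "A\<^sub>1 \<noteq> {}" "A\<^sub>2 \<noteq> {}" "B \<noteq> {}"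
    "(A\<^sub>1 \<union> A\<^sub>2, B) \<in> \<rho>"
  obtains B\<^sub>1 B\<^sub>2 where "B\<^sub>1 \<noteq> {}" "B\<^sub>2 \<noteq> {}" "B = B\<^sub>1 \<union> B\<^sub>2" "(A\<^sub>1, B\<^sub>1) \<in> \<rho>" "(A\<^sub>2, B\<^sub>2) \<in> \<rho>"
  using assms(1)[unfolded asymptotic_resemblance_def, THEN conjunct2, THEN conjunct2,
      rule_format, of A\<^sub>1 A\<^sub>2 B] assms(2-8) that
  by blast

text \<open>LS-regularity is applied to the two-member family of
  \<open>A\<^sub>1 \<union> A\<^sub>2\<close> and \<open>B\<close>: membership of \<open>B\<close>
  in the resulting join splits it into parts related to \<open>A\<^sub>1\<close> and
  \<open>A\<^sub>2\<close>. Such a part may be empty, whereas the axiom wants nonempty ones, so an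
  empty part is replaced.\<close>

lemma asymptotic_resemblance_pair_rel:
  assumes lsr: "ls_resemblance X \<CC>" and con: "lsr_connected X \<CC>" and reg: "ls_regular X \<CC>"
  shows "asymptotic_resemblance X (pair_rel X \<CC>)"
  unfolding asymptotic_resemblance_def
proof (intro conjI allI impI)
  note eq = pair_rel_equiv[OF lsr]
  show "equiv (Pow X) (pair_rel X \<CC>)" by (rule eq)
  show "(A\<^sub>1 \<union> A\<^sub>2, B\<^sub>1 \<union> B\<^sub>2) \<in> pair_rel X \<CC>"
    if "(A\<^sub>1, B\<^sub>1) \<in> pair_rel X \<CC> \<and> (A\<^sub>2, B\<^sub>2) \<in> pair_rel X \<CC>" for A\<^sub>1 B\<^sub>1 A\<^sub>2 B\<^sub>2
    using that pair_rel_Un[OF lsr] by blast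
  \<comment> \<open>The replacement is a singleton \<open>{b}\<close> with \<open>b\<close> in
    \<open>B\<close>: it is related to the empty set, hence to \<open>A\<close>, and adding it does
    not change \<open>B\<close>.\<close>
  have nonempty: "\<exists>B'. B' \<noteq> {} \<and> B' \<union> B = B \<and> (A, B') \<in> pair_rel X \<CC>"
    if "B \<subseteq> X" "B \<noteq> {}" "A \<noteq> {}" "(A, {}) \<in> pair_rel X \<CC>" for A B
  proof -
    from that obtain b where b: "b \<in> B" "b \<in> X" by auto
    then have "(A, {b}) \<in> pair_rel X \<CC>"
      using points_related_empty[OF lsr con that(4,3)] eq that(4) by (meson equivE symD transD)
    then show ?thesis
      using b by blast
  qed
  fix A\<^sub>1 A\<^sub>2 B
  assume *: "A\<^sub>1 \<subseteq> X \<and> A\<^sub>2 \<subseteq> X \<and> B \<subseteq> X \<and> A\<^sub>1 \<noteq> {} \<and> A\<^sub>2 \<noteq> {} \<and> B \<noteq> {} \<and>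
    (A\<^sub>1 \<union> A\<^sub>2, B) \<in> pair_rel X \<CC>"
  then have "{A\<^sub>1 \<union> A\<^sub>2, B} \<in> \<CC>"
    by (simp add: pair_rel_def)
  then obtain \<A>\<^sub>1 \<A>\<^sub>2 where \<A>: "\<A>\<^sub>1 \<in> \<CC>" "\<A>\<^sub>2 \<in> \<CC>" "A\<^sub>1 \<in> \<A>\<^sub>1" "A\<^sub>2 \<in> \<A>\<^sub>2"
    "{A\<^sub>1 \<union> A\<^sub>2, B} \<subseteq> \<A>\<^sub>1 \<or>\<^sub>f \<A>\<^sub>2"
    using ls_regularE[OF reg, of _ A\<^sub>1 A\<^sub>2] * by (metis insertI1)
  then obtain B\<^sub>1 B\<^sub>2 where B: "B = B\<^sub>1 \<union> B\<^sub>2" "B\<^sub>1 \<in> \<A>\<^sub>1" "B\<^sub>2 \<in> \<A>\<^sub>2"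
    by (auto simp: family_join_def)
  have rel: "(A\<^sub>1, B\<^sub>1) \<in> pair_rel X \<CC>" "(A\<^sub>2, B\<^sub>2) \<in> pair_rel X \<CC>"
    using clique_families_pair_rel_superset[OF lsr] \<A> B
    by (auto simp: clique_families_def)
  show "\<exists>B\<^sub>1 B\<^sub>2. B\<^sub>1 \<noteq> {} \<and> B\<^sub>2 \<noteq> {} \<and> B = B\<^sub>1 \<union> B\<^sub>2 \<and>
    (A\<^sub>1, B\<^sub>1) \<in> pair_rel X \<CC> \<and> (A\<^sub>2, B\<^sub>2) \<in> pair_rel X \<CC>"
  \<comment> \<open>If one part is empty, the other is all of \<open>B\<close> and so nonempty; at
    most one part ever needs replacing.\<close>
  proof (cases "B\<^sub>1 = {}")
    case True
    then obtain B' where "B' \<noteq> {}" "B' \<union> B = B" "(A\<^sub>1, B') \<in> pair_rel X \<CC>"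
      using nonempty[of B A\<^sub>1] rel * by blast
    then show ?thesis
      using True B rel * by (intro exI[of _ B'] exI[of _ B\<^sub>2]) auto
  next
    case ne: False
    show ?thesis
    proof (cases "B\<^sub>2 = {}")
      case True
      then obtain B' where "B' \<noteq> {}" "B' \<union> B = B" "(A\<^sub>2, B') \<in> pair_rel X \<CC>"
        using nonempty[of B A\<^sub>2] rel * by blast
      then show ?thesis
        using True B rel * by (intro exI[of _ B\<^sub>1] exI[of _ B']) auto
    qed (use B rel ne in blast)
  qed
qed

text \<open>The splitting axiom is silent about an empty right-hand side. Adding a point
  \<open>a\<close> of \<open>A\<^sub>1\<close> to both sides turns that side into
  \<open>{a}\<close>, to which the axiom applies; transitivity leads back to the empty set.\<close>

lemma asymptotic_resemblance_split_empty:
  assumes \<rho>: "asymptotic_resemblance X \<rho>" and rel: "(A\<^sub>1 \<union> A\<^sub>2, {}) \<in> \<rho>"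
    and ne: "A\<^sub>1 \<noteq> {}" "A\<^sub>2 \<noteq> {}"
  shows "(A\<^sub>1, {}) \<in> \<rho> \<and> (A\<^sub>2, {}) \<in> \<rho>"
proof -
  have eq: "equiv (Pow X) \<rho>"
    using \<rho> by (simp add: asymptotic_resemblance_def)
  then have sub: "A\<^sub>1 \<union> A\<^sub>2 \<subseteq> X"
    using rel by (auto simp: equiv_def refl_on_def)
  obtain a where a: "a \<in> A\<^sub>1"
    using ne by auto
  then have "({a}, {a}) \<in> \<rho>"
    using eq sub by (auto simp: equiv_def refl_on_def)
  then have "(A\<^sub>1 \<union> A\<^sub>2 \<union> {a}, {} \<union> {a}) \<in> \<rho>"
    by (rule asymptotic_resemblance_Un[OF \<rho> rel])
  moreover have "A\<^sub>1 \<union> A\<^sub>2 \<union> {a} = A\<^sub>1 \<union> A\<^sub>2"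
    using a by auto
  ultimately have rel': "(A\<^sub>1 \<union> A\<^sub>2, {a}) \<in> \<rho>"
    by simp
  have "A\<^sub>1 \<subseteq> X" "A\<^sub>2 \<subseteq> X" "{a} \<subseteq> X" "{a} \<noteq> {}"
    using sub a by auto
  then obtain B\<^sub>1 B\<^sub>2 where "B\<^sub>1 \<noteq> {}" "B\<^sub>2 \<noteq> {}" "{a} = B\<^sub>1 \<union> B\<^sub>2"
    "(A\<^sub>1, B\<^sub>1) \<in> \<rho>" "(A\<^sub>2, B\<^sub>2) \<in> \<rho>"
    using asymptotic_resemblance_splitE[OF \<rho>] ne rel' by metis
  \<comment> \<open>Nonempty parts of a singleton equal the singleton.\<close>
  then have "(A\<^sub>1, {a}) \<in> \<rho>" "(A\<^sub>2, {a}) \<in> \<rho>"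
    by (metis Un_singleton_iff)+
  then show ?thesis
    using eq rel rel' by (meson equivE symD transD)
qed

text \<open>Overlapping cliques merge by transitivity through a common member, and joins of cliques
  are cliques by compatibility of \<rho> with unions.\<close>

lemma ls_resemblance_clique_families:
  assumes \<rho>: "asymptotic_resemblance X \<rho>" and "X \<noteq> {}"
  shows "ls_resemblance X (clique_families X \<rho>)"
proof -
  have eq: "equiv (Pow X) \<rho>"
    using \<rho> by (simp add: asymptotic_resemblance_def)
  have "\<A> \<union> \<B> \<in> clique_families X \<rho>"
    if AB: "\<A> \<in> clique_families X \<rho>" "\<B> \<in> clique_families X \<rho>" "\<A> \<inter> \<B> \<noteq> {}" for \<A> \<B>
  proof -
    from AB(3) obtain D where D: "D \<in> \<A>" "D \<in> \<B>" by auto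
    then have "(A, D) \<in> \<rho> \<and> (D, A) \<in> \<rho>" if "A \<in> \<A> \<union> \<B>" for A
      using that AB by (auto simp: clique_families_def)
    then have "(A, B) \<in> \<rho>" if "A \<in> \<A> \<union> \<B>" "B \<in> \<A> \<union> \<B>" for A B
      using that eq by (meson equivE transD)
    then show ?thesis
      using AB by (simp add: clique_families_def)
  qed
  moreover have "\<A> \<or>\<^sub>f \<B> \<in> clique_families X \<rho>"
    if "\<A> \<in> clique_families X \<rho>" "\<B> \<in> clique_families X \<rho>" for \<A> \<B>
    using that asymptotic_resemblance_Un[OF \<rho>]
    by (auto simp: clique_families_def family_join_def)
  moreover have "{A} \<in> clique_families X \<rho>" if "A \<subseteq> X" for A
    using that eq by (auto simp: clique_families_def equiv_def refl_on_def)
  moreover have "clique_families X \<rho> \<subseteq> Pow (Pow X)"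
    by (auto simp: clique_families_def)
  moreover have "\<forall>\<A> \<B>. \<B> \<subseteq> \<A> \<and> \<A> \<in> clique_families X \<rho> \<longrightarrow> \<B> \<in> clique_families X \<rho>"
    unfolding clique_families_def by blast
  ultimately show ?thesis
    using assms(2) by (simp add: ls_resemblance_def)
qed

text \<open>The families witnessing LS-regularity are the equivalence classes of
  \<open>A\<^sub>1\<close> and \<open>A\<^sub>2\<close>, the largest cliques containing them. Each
  member of \<A> is related to the union of the two sets, so it splits into members of these
  classes.\<close>

lemma a_lsr_clique_families:
  assumes \<rho>: "asymptotic_resemblance X \<rho>"
  shows "a_lsr X (clique_families X \<rho>)"
proof -
  have eq: "equiv (Pow X) \<rho>"
    using \<rho> by (simp add: asymptotic_resemblance_def)
  have cls: "\<rho> `` {A} \<in> clique_families X \<rho> \<and> A \<in> \<rho> `` {A}" if "A \<subseteq> X" for A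
    using eq that unfolding clique_families_def equiv_def refl_on_def
    by (auto dest: symD transD)
  have "\<A> \<subseteq> \<rho> `` {A\<^sub>1} \<or>\<^sub>f \<rho> `` {A\<^sub>2}"
    if "\<A> \<in> clique_families X \<rho>" "A\<^sub>1 \<subseteq> X" "A\<^sub>2 \<subseteq> X" "A\<^sub>1 \<noteq> {}" "A\<^sub>2 \<noteq> {}" "A\<^sub>1 \<union> A\<^sub>2 \<in> \<A>" for \<A> A\<^sub>1 A\<^sub>2
  proof
    fix B assume "B \<in> \<A>"
    then have B: "(A\<^sub>1 \<union> A\<^sub>2, B) \<in> \<rho>" "B \<subseteq> X"
      using that by (auto simp: clique_families_def)
    have "\<exists>B\<^sub>1 B\<^sub>2. B = B\<^sub>1 \<union> B\<^sub>2 \<and> (A\<^sub>1, B\<^sub>1) \<in> \<rho> \<and> (A\<^sub>2, B\<^sub>2) \<in> \<rho>"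
    \<comment> \<open>An empty \<open>B\<close> is the union of two empty parts, each related to its
      \<open>A\<^sub>i\<close> by the preceding lemma.\<close>
    proof (cases "B = {}")
      case True
      then show ?thesis
        using asymptotic_resemblance_split_empty[OF \<rho>] B that(4,5) by blast
    next
      case False
      then show ?thesis
        using asymptotic_resemblance_splitE[OF \<rho>] B that(2-5) by metis
    qed
    then show "B \<in> \<rho> `` {A\<^sub>1} \<or>\<^sub>f \<rho> `` {A\<^sub>2}"
      by (auto simp: family_join_def)
  qed
  then have "ls_regular X (clique_families X \<rho>)"
    unfolding ls_regular_def using cls by meson
  moreover have "\<A> \<in> clique_families X \<rho>"
    if "\<A> \<subseteq> Pow X" "\<forall>A\<in>\<A>. \<forall>B\<in>\<A>. {A, B} \<in> clique_families X \<rho>" for \<A>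
    using that by (auto simp: clique_families_def)
  ultimately show ?thesis
    by (auto simp: a_lsr_def)
qed

section \<open>Morphisms\<close>

lemma asr_bounded_pair_rel:
  "ls_resemblance X \<CC> \<Longrightarrow> asr_bounded X (pair_rel X \<CC>) B \<longleftrightarrow> lsr_bounded X \<CC> B"
  by (auto simp: asr_bounded_def lsr_bounded_def pair_rel_iff)

text \<open>Preservation of families is applied to families of the form \<open>{A, B}\<close>;
  boundedness already means the same on both sides.\<close>

lemma lsr_mapping_imp_asr_mapping:
  assumes "ls_resemblance X \<CC>" "ls_resemblance Y \<DD>" "lsr_mapping X \<CC> Y \<DD> f"
  shows "asr_mapping X (pair_rel X \<CC>) Y (pair_rel Y \<DD>) f"
proof -
  have "{f ` A, f ` B} \<in> \<DD>" if "{A, B} \<in> \<CC>" for A B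
    using assms(3) that by (fastforce simp: lsr_mapping_def)
  then show ?thesis
    using assms by (auto simp: asr_mapping_def lsr_mapping_def asr_bounded_pair_rel pair_rel_iff)
qed

text \<open>The image of a family in \<CC> has pairwise related members, and an A-LS.R target
  contains every such family. The A-LS.R condition falls on the target alone, which is what makes
  the reflection work for LS-regular sources.\<close>

lemma asr_mapping_imp_lsr_mapping:
  assumes "ls_resemblance X \<CC>" "ls_resemblance Y \<DD>" "a_lsr Y \<DD>"
    "asr_mapping X (pair_rel X \<CC>) Y (pair_rel Y \<DD>) f"
  shows "lsr_mapping X \<CC> Y \<DD> f"
proof -
  have "(\<lambda>A. f ` A) ` \<A> \<in> \<DD>" if "\<A> \<in> \<CC>" for \<A>
  proof -
    have "\<A> \<in> clique_families X (pair_rel X \<CC>)"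
      using that clique_families_pair_rel_superset assms(1) by blast
    then have "(f ` A, f ` B) \<in> pair_rel Y \<DD>" if "A \<in> \<A>" "B \<in> \<A>" for A B
      using that assms(4) by (simp add: clique_families_def asr_mapping_def subset_iff)
    then have "(\<lambda>A. f ` A) ` \<A> \<in> clique_families Y (pair_rel Y \<DD>)"
      by (fastforce simp: clique_families_def pair_rel_def)
    then show ?thesis
      using clique_families_pair_rel assms by blast
  qed
  then show ?thesis
    using assms by (auto simp: asr_mapping_def lsr_mapping_def asr_bounded_pair_rel)
qed

section \<open>The concrete categories of spaces: identities and composites\<close>

abbreviation "LSR_objects \<equiv> {(X, \<CC>). ls_resemblance X \<CC> \<and> lsr_connected X \<CC>}"
abbreviation "ASR_objects \<equiv> {(X, \<rho>). X \<noteq> {} \<and> asymptotic_resemblance X \<rho> \<and> asr_connected X \<rho>}"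
abbreviation "LSR_maps \<equiv> (\<lambda>(X, \<CC>) (Y, \<DD>) f. lsr_mapping X \<CC> Y \<DD> f)"
abbreviation "ASR_maps \<equiv> (\<lambda>(X, \<rho>) (Y, \<sigma>) f. asr_mapping X \<rho> Y \<sigma> f)"

text \<open>Intersecting with \<open>Y\<close> puts the inner preimage in the form produced by the
  boundedness condition for \<open>g\<close>, so that the condition for \<open>f\<close> applies to
  it.\<close>

lemma vimage_compose_on:
  "f \<in> X \<rightarrow> Y \<Longrightarrow> X \<inter> compose X g f -` B = X \<inter> f -` (Y \<inter> g -` B)"
  by (auto simp: compose_def)

lemma image_compose_on: "A \<subseteq> X \<Longrightarrow> compose X g f ` A = g ` f ` A"
  by (force simp: compose_def)

lemma lsr_mapping_compose:
  assumes "ls_resemblance X \<CC>" "lsr_mapping X \<CC> Y \<DD> f" "lsr_mapping Y \<DD> Z \<EE> g"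
  shows "lsr_mapping X \<CC> Z \<EE> (compose X g f)"
proof -
  have f: "f \<in> X \<rightarrow> Y" and g: "g \<in> Y \<rightarrow> Z"
    using assms by (auto simp: lsr_mapping_def)
  have "(\<lambda>A. compose X g f ` A) ` \<A> \<in> \<EE>" if "\<A> \<in> \<CC>" for \<A>
  proof -
    have "\<A> \<subseteq> Pow X"
      using assms(1) that by (auto simp: ls_resemblance_def)
    then have "(\<lambda>A. compose X g f ` A) ` \<A> = (\<lambda>A. g ` A) ` (\<lambda>A. f ` A) ` \<A>"
      by (simp add: image_image image_compose_on subset_iff cong: image_cong)
    then show ?thesis
      using assms that by (simp add: lsr_mapping_def)
  qed
  moreover have "compose X g f \<in> X \<rightarrow> Z"
    using f g by (auto simp: compose_def)
  ultimately show ?thesis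
    using assms by (auto simp: lsr_mapping_def vimage_compose_on[OF f])
qed

lemma asr_mapping_compose:
  assumes "asr_mapping X \<rho> Y \<sigma> f" "asr_mapping Y \<sigma> Z \<tau> g"
  shows "asr_mapping X \<rho> Z \<tau> (compose X g f)"
proof -
  have f: "f \<in> X \<rightarrow> Y" and g: "g \<in> Y \<rightarrow> Z"
    using assms by (auto simp: asr_mapping_def)
  have "(compose X g f ` A, compose X g f ` B) \<in> \<tau>"
    if "A \<subseteq> X" "B \<subseteq> X" "(A, B) \<in> \<rho>" for A B
  proof -
    have "f ` A \<subseteq> Y" "f ` B \<subseteq> Y"
      using f that by auto
    then show ?thesis
      using assms that by (simp add: image_compose_on asr_mapping_def)
  qed
  moreover have "compose X g f \<in> X \<rightarrow> Z"
    using f g by (auto simp: compose_def)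
  ultimately show ?thesis
    using assms by (auto simp: asr_mapping_def vimage_compose_on[OF f])
qed

lemma vimage_ident_on: "B \<subseteq> X \<Longrightarrow> X \<inter> restrict (\<lambda>x. x) X -` B = B"
  by auto

lemma image_ident_on: "A \<subseteq> X \<Longrightarrow> restrict (\<lambda>x. x) X ` A = A"
  by force

lemma structured_maps_LSR: "structured_maps LSR_objects LSR_maps"
proof
  fix P :: "'a lsr_space" assume "P \<in> LSR_objects"
  then obtain X \<CC> where P: "P = (X, \<CC>)" "ls_resemblance X \<CC>" by auto
  have "(\<lambda>A. restrict (\<lambda>x. x) X ` A) ` \<A> = \<A>" if "\<A> \<in> \<CC>" for \<A>
  proof -
    have "\<A> \<subseteq> Pow X"
      using P that by (auto simp: ls_resemblance_def)
    then show ?thesis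
      by (simp add: image_ident_on subset_iff cong: image_cong)
  qed
  moreover have "X \<inter> restrict (\<lambda>x. x) X -` B = B" if "lsr_bounded X \<CC> B" for B
    using that by (intro vimage_ident_on) (auto simp: lsr_bounded_def)
  ultimately show "LSR_maps P P (restrict (\<lambda>x. x) (fst P))"
    by (simp add: P lsr_mapping_def)
next
  fix P Q R :: "'a lsr_space" and f g
  assume "P \<in> LSR_objects" "LSR_maps P Q f" "LSR_maps Q R g"
  then show "LSR_maps P R (compose (fst P) g f)"
    by (auto intro: lsr_mapping_compose)
qed

lemma structured_maps_ASR: "structured_maps ASR_objects ASR_maps"
proof
  fix P :: "'a asr_space" assume "P \<in> ASR_objects"
  then obtain X \<rho> where P: "P = (X, \<rho>)" by auto
  have "X \<inter> restrict (\<lambda>x. x) X -` B = B" if "asr_bounded X \<rho> B" for B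
    using that by (intro vimage_ident_on) (auto simp: asr_bounded_def)
  moreover have "(restrict (\<lambda>x. x) X ` A, restrict (\<lambda>x. x) X ` B) \<in> \<rho>"
    if "A \<subseteq> X" "B \<subseteq> X" "(A, B) \<in> \<rho>" for A B
    using that by (simp only: image_ident_on)
  ultimately show "ASR_maps P P (restrict (\<lambda>x. x) (fst P))"
    by (simp add: P asr_mapping_def )
next
  fix P Q R :: "'a asr_space" and f g
  assume "ASR_maps P Q f" "ASR_maps Q R g"
  then show "ASR_maps P R (compose (fst P) g f)"
    by (auto intro: asr_mapping_compose split: prod.splits)
qed

section \<open>Objects, isomorphism and reflection\<close>

lemma pair_rel_object:
  assumes "ls_resemblance X \<CC>" "lsr_connected X \<CC>" "ls_regular X \<CC>"
  shows "(X, pair_rel X \<CC>) \<in> ASR_objects"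
  using assms asymptotic_resemblance_pair_rel[OF assms]
  by (auto simp: asr_connected_def lsr_connected_def pair_rel_iff ls_resemblance_def)

lemma clique_families_object:
  assumes "(X, \<rho>) \<in> ASR_objects"
  shows "(X, clique_families X \<rho>) \<in> LSR_objects \<inter> {(X, \<CC>). a_lsr X \<CC>}"
proof -
  have eq: "equiv (Pow X) \<rho>"
    using assms by (simp add: asymptotic_resemblance_def)
  have "lsr_connected X (clique_families X \<rho>)"
    using assms by (auto simp: lsr_connected_def clique_families_def asr_connected_def)
  then show ?thesis
    using assms ls_resemblance_clique_families a_lsr_clique_families by auto
qed

theorem theorem6p11:
  shows "isomorphic_categories (ALSR_cat :: 'a lsr_cat) (ASR_cat :: 'a asr_cat) \<and>
         reflective_full_subcategory (ALSR_cat :: 'a lsr_cat) (LS_regular_cat :: 'a lsr_cat)"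
proof
  let ?A = "LSR_objects \<inter> {(X, \<CC>). a_lsr X \<CC>} :: 'a lsr_space set"
  let ?R = "LSR_objects \<inter> {(X, \<CC>). ls_regular X \<CC>} :: 'a lsr_space set"
  let ?B = "ASR_objects :: 'a asr_space set"
  let ?F = "\<lambda>(X, \<CC>). (X, pair_rel X \<CC>) :: 'a asr_space"
  let ?G = "\<lambda>(X, \<rho>). (X, clique_families X \<rho>) :: 'a lsr_space"
  note lsr = structured_maps_LSR[where 'a = 'a] and asr = structured_maps_ASR[where 'a = 'a]
  have A: "structured_maps ?A LSR_maps" and R: "structured_maps ?R LSR_maps"
    by (rule structured_maps.restrict_objects[OF lsr], simp)+
  have AR: "?A \<subseteq> ?R"
    by (auto simp: a_lsr_def)
  have F: "?F P \<in> ?B" if "P \<in> ?R" for P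
    using that pair_rel_object by auto
  have G: "?G P \<in> ?A" if "P \<in> ?B" for P
    using that clique_families_object[of "fst P" "snd P"] by (cases P) simp
  have FG: "?F (?G P) = P" if "P \<in> ?B" for P
    using that by (auto simp: asymptotic_resemblance_def pair_rel_clique_families)
  have GF: "?G (?F P) = P" if "P \<in> ?A" for P
    using that by (auto simp: clique_families_pair_rel)
  have maps: "LSR_maps P Q f \<Longrightarrow> ASR_maps (?F P) (?F Q) f" if "P \<in> ?R" "Q \<in> ?R" for P Q f
    using that by (auto intro: lsr_mapping_imp_asr_mapping)
  \<comment> \<open>The asymmetric hypotheses cover both uses: the isomorphism, where source and
    target lie in \<open>?A\<close>, and the unit, where the source is an arbitrary object of
    \<open>?R\<close>.\<close>
  have maps_iff: "ASR_maps (?F P) (?F Q) f \<longleftrightarrow> LSR_maps P Q f" if "P \<in> ?R" "Q \<in> ?A" for P Q f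
    using that by (auto intro: lsr_mapping_imp_asr_mapping asr_mapping_imp_lsr_mapping)
  have "isomorphic_categories (structured_cat ?A LSR_maps) (structured_cat ?B ASR_maps)"
  proof (rule isomorphic_structured_cats[OF A asr])
    show "?F P \<in> ?B" if "P \<in> ?A" for P
      by (rule F[OF subsetD[OF AR that]])
    show "fst (?F P) = fst P" for P :: "'a lsr_space"
      by (simp add: case_prod_beta)
    show "ASR_maps (?F P) (?F Q) f \<longleftrightarrow> LSR_maps P Q f" if "P \<in> ?A" "Q \<in> ?A" for P Q f
      using maps_iff[OF subsetD[OF AR that(1)] that(2)] .
  qed (rule G FG GF, assumption)+
  then show "isomorphic_categories (ALSR_cat :: 'a lsr_cat) (ASR_cat :: 'a asr_cat)"
    by (simp add: ALSR_cat_def ASR_cat_def LSR_cat_def full_subcat_structured_cat)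
  let ?L = "\<lambda>P. ?G (?F P)"
  have L: "?L P \<in> ?A" if "P \<in> ?R" for P
    by (rule G[OF F[OF that]])
  \<comment> \<open>Reflection leaves the induced relation unchanged.\<close>
  have FL: "?F (?L P) = ?F P" if "P \<in> ?R" for P
    by (rule FG[OF F[OF that]])
  \<comment> \<open>By \<open>maps_iff\<close>, both sides say that \<open>f\<close> is an AS.R
    mapping, and by \<open>FL\<close> for the same relations.\<close>
  have unit: "LSR_maps (?L P) Q f \<longleftrightarrow> LSR_maps P Q f" if "P \<in> ?R" "Q \<in> ?A" for P Q f
    using maps_iff[OF subsetD[OF AR L[OF that(1)]] that(2)] maps_iff[OF that]
    by (simp only: FL[OF that(1)])
  \<comment> \<open>The target \<open>?L Q\<close> is A-LS.R, so it suffices that \<open>f\<close>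
    is an AS.R mapping for the relations of \<open>P\<close> and \<open>Q\<close>, which holds by
    \<open>maps\<close>.\<close>
  have "LSR_maps (?L P) (?L Q) f" if "P \<in> ?R" "Q \<in> ?R" "LSR_maps P Q f" for P Q f
    using maps_iff[OF subsetD[OF AR L[OF that(1)]] L[OF that(2)]] maps[OF that]
    by (simp only: FL[OF that(1)] FL[OF that(2)])
  then have "reflective_full_subcategory (structured_cat ?A LSR_maps) (structured_cat ?R LSR_maps)"
    by (intro reflective_structured_cat[OF R AR, where L = ?L] L unit) (auto simp: case_prod_beta)
  then show "reflective_full_subcategory (ALSR_cat :: 'a lsr_cat) (LS_regular_cat :: 'a lsr_cat)"
    by (simp add: ALSR_cat_def LS_regular_cat_def LSR_cat_def full_subcat_structured_cat)
qed

end
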